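(* Let $(X,d)$ be a good discrete hyperbolic space endowed with an isometric action of a group $G$, and let $\delta$ be a nonzero natural number (a positive integer) such that $(X,d)$ is $\delta$-hyperbolic. Then there exists a $G$-equivariant map $(x,a)\mapsto \mu_x(a)$ from $X\times X$ to the set of probability measures on $X$ such that: (i) for all $x,a\in X$, the support of $\mu_x(a)$ is contained in $B(a,4\delta)\cap 2\delta\text{-}\mathrm{geod}(x,a)$, and even in $S(a,4\delta)\cap 2\delta\text{-}\mathrm{geod}(x,a)$ if $d(x,a)\geq 4\delta$; (ii) there exist a real number $\epsilon>0$ and a constant $C$ such that for all $x,x',a\in X$, if $d(x,x')=1$ then $\|\mu_x(a)-\mu_{x'}(a)\|_1\leq C e^{-\epsilon d(x,a)}$; (iii) there exists a real number $\eta>0$ such that, if the distance $d(x,x')$ is sufficiently large (i.e. for all $x,x'\in X$ with $d(x,x')$ at least some constant), then the number of $a\in X$ such that the supports of $\mu_x(a)$ and $\mu_{x'}(a)$ are disjoint is at least $\eta\cdot d(x,x')$.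
   Context: Let $(X,d)$ be a metric space. For a real $\delta\ge 0$, $(X,d)$ is $\delta$-hyperbolic if for all $x_1,x_2,x_3,x_4\in X$, $$d(x_1,x_4)+d(x_2,x_3)\leq \max\big(d(x_1,x_2)+d(x_3,x_4),\,d(x_1,x_3)+d(x_2,x_4)\big)+\delta;$$ it is hyperbolic if it is $\delta$-hyperbolic for some real $\delta\geq 0$. $(X,d)$ is uniformly locally finite if for every real $r\geq 0$ there is an integer $K$ such that every closed ball of radius $r$ contains at most $K$ points. A good discrete hyperbolic space is a hyperbolic, uniformly locally finite metric space whose metric comes from a graph structure (i.e. $d$ is the path metric, with values in $\mathbf{N}$, on the vertex set $X$ of a connected graph). Notation: $B(x,r)=\{y\in X: d(x,y)\leq r\}$, $S(x,r)=\{y\in X: d(x,y)=r\}$, and for a real $\epsilon\geq 0$, $\epsilon\text{-}\mathrm{geod}(x,y)=\{z\in X: d(x,z)+d(z,y)\leq d(x,y)+\epsilon\}$. $G$-equivariance means $\mu_{g x}(g a)=g_*\mu_x(a)$ for all $g\in G$, $x,a\in X$. For a signed measure $\nu$ on the discrete set $X$, $\|\nu\|_1=\sum_{y\in X}|\nu(\{y\})|$. *)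

theory Defs
  imports "HOL-Algebra.Group_Action" "HOL-Probability.Probability"
begin

context Metric_space
begin

definition msphere :: "'a \<Rightarrow> real \<Rightarrow> 'a set" where
  "msphere x r = {y. x \<in> M \<and> y \<in> M \<and> d x y = r}"

definition geod :: "real \<Rightarrow> 'a \<Rightarrow> 'a \<Rightarrow> 'a set" where
  "geod \<epsilon> x y = {z \<in> M. d x z + d z y \<le> d x y + \<epsilon>}"

definition delta_hyperbolic :: "real \<Rightarrow> bool" where
  "delta_hyperbolic \<delta> \<longleftrightarrow>
     (\<forall>x1\<in>M. \<forall>x2\<in>M. \<forall>x3\<in>M. \<forall>x4\<in>M.
        d x1 x4 + d x2 x3 \<le> max (d x1 x2 + d x3 x4) (d x1 x3 + d x2 x4) + \<delta>)"

definition hyperbolic :: bool where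
  "hyperbolic \<longleftrightarrow> (\<exists>\<delta>\<ge>0. delta_hyperbolic \<delta>)"

definition uniformly_locally_finite :: bool where
  "uniformly_locally_finite \<longleftrightarrow>
     (\<forall>r\<ge>0. \<exists>K::nat. \<forall>x\<in>M. finite (mcball x r) \<and> card (mcball x r) \<le> K)"

text \<open>A simple graph on the vertex set is given by its symmetric irreflexive set \<open>E\<close> of
  edges. The pairs in \<open>E ^^ n\<close> are those joined by a path with \<open>n\<close> edges.\<close>

definition graph_metric :: bool where
  "graph_metric \<longleftrightarrow>
     (\<exists>E. E \<subseteq> M \<times> M \<and> sym E \<and> irrefl E \<and>
        (\<forall>x\<in>M. \<forall>y\<in>M. (x, y) \<in> E\<^sup>*) \<and>
        (\<forall>x\<in>M. \<forall>y\<in>M. d x y = real (LEAST n. (x, y) \<in> E ^^ n)))"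

end

locale good_discrete_hyperbolic_space = Metric_space +
  assumes hyperbolic: hyperbolic
    and uniformly_locally_finite: uniformly_locally_finite
    and graph_metric: graph_metric

locale isometric_action = Metric_space M d + group_action G M \<phi>
  for M :: "'a set" and d :: "'a \<Rightarrow> 'a \<Rightarrow> real"
    and G :: "('g, 'm) monoid_scheme" and \<phi> :: "'g \<Rightarrow> 'a \<Rightarrow> 'a" +
  assumes isometric:
    "\<lbrakk>g \<in> carrier G; x \<in> M; y \<in> M\<rbrakk> \<Longrightarrow> d (\<phi> g x) (\<phi> g y) = d x y"

text \<open>A signed measure on a discrete set is identified with its mass function \<open>y \<mapsto> \<nu> {y}\<close>.
  For a difference of two probability mass functions the sum below always converges.\<close>

definition l1_norm :: "'a set \<Rightarrow> ('a \<Rightarrow> real) \<Rightarrow> real" where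
  "l1_norm X \<nu> = (\<Sum>\<^sub>\<infinity>y\<in>X. \<bar>\<nu> y\<bar>)"

end

theory Submission
  imports Defs
begin

text \<open>
  From \<open>x\<close> walk towards \<open>a\<close> on the spheres around \<open>a\<close> whose radii are multiples of \<open>4\<delta>\<close>: each
  step jumps to a uniformly chosen point of the next smaller sphere among those that lie in the
  \<open>\<delta>\<close>-geodesic hull of the current point and \<open>a\<close>. The measure \<open>\<mu>\<^sub>x(a)\<close> is the law of the walk when it
  reaches the sphere of radius \<open>4\<delta>\<close> (and the Dirac mass at \<open>x\<close> if \<open>d(x,a) < 4\<delta>\<close>). It is
  equivariant because only the metric enters the construction. Three facts carry the proof.

  \<^item> Errors do not add up. By the four-point inequality a step of length about \<open>4\<delta>\<close> brings the walk
    back to within \<open>2\<delta>\<close> of being geodesic from the starting point, even after a deviation of up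
    to \<open>9\<delta>\<close> (\<open>slack_after_step\<close>, \<open>walk_factor\<close>). This gives (i).

  \<^item> Walks couple. Two walkers on the same sphere that started at adjacent points are at distance
    at most \<open>5\<delta>\<close> (\<open>sphere_geod_close\<close>), so the point where a geodesic from the one meets the next sphere is
    an admissible target for the other as well (\<open>common_target\<close>). By uniform local finiteness both
    jump to it with probability at least \<open>1/K\<close>, and therefore the \<open>\<ell>\<^sup>1\<close> distance of the laws shrinks
    by the factor \<open>1 - 1/K\<^sup>2\<close> at every step (\<open>l1_bind_contract\<close>, \<open>walk_contract\<close>). The number of steps
    grows linearly with \<open>d(x,a)\<close>, which gives (ii).

  \<^item> If \<open>a\<close> is on a geodesic from \<open>x\<close> to \<open>x'\<close> at distance at least \<open>4\<delta>\<close> from both ends, then a common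
    point of the two supports would be closer than \<open>a\<close> to both ends by \<open>2\<delta>\<close>, which
    contradicts the triangle inequality (\<open>disjoint_supports\<close>). This gives (iii).
\<close>

section \<open>Distance of finitely supported laws\<close>

lemma l1_pmf_le_2:
  fixes p q :: "'a pmf"
  assumes "finite B"
  shows "(\<Sum>y\<in>B. \<bar>pmf p y - pmf q y\<bar>) \<le> 2"
proof -
  have le1: "(\<Sum>y\<in>B. pmf r y) \<le> 1" for r :: "'a pmf"
    using measure_measure_pmf_finite[OF assms, of r] measure_pmf.prob_le_1[of r B] by simp
  have "(\<Sum>y\<in>B. \<bar>pmf p y - pmf q y\<bar>) \<le> (\<Sum>y\<in>B. pmf p y + pmf q y)"
    by (intro sum_mono) (smt (verit) pmf_nonneg)
  also have "\<dots> \<le> 2"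
    using le1[of p] le1[of q] by (simp add: sum.distrib)
  finally show ?thesis .
qed

text \<open>Couple the initial laws \<open>p\<close> and \<open>q\<close> independently: with probability \<open>pmf p z * pmf q z\<close> both
  samples are \<open>z\<close>, and then the two continuations do not differ.\<close>

lemma l1_bind_contract:
  fixes \<kappa> :: "'a \<Rightarrow> 'b pmf"
  assumes fp: "finite (set_pmf p)" and fq: "finite (set_pmf q)" and fB: "finite B"
    and bound: "\<And>u v. u \<in> set_pmf p \<Longrightarrow> v \<in> set_pmf q \<Longrightarrow>
      (\<Sum>y\<in>B. \<bar>pmf (\<kappa> u) y - pmf (\<kappa> v) y\<bar>) \<le> b"
  shows "(\<Sum>y\<in>B. \<bar>pmf (bind_pmf p \<kappa>) y - pmf (bind_pmf q \<kappa>) y\<bar>) \<le> (1 - pmf p z * pmf q z) * b"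
proof -
  let ?P = "set_pmf p" and ?Q = "set_pmf q"
  let ?w = "\<lambda>uv. pmf p (fst uv) * pmf q (snd uv)"
  let ?D = "\<lambda>uv y. pmf (\<kappa> (fst uv)) y - pmf (\<kappa> (snd uv)) y"
  let ?c = "\<lambda>uv. if uv = (z, z) then pmf p z * pmf q z else 0"
  have sp: "(\<Sum>u\<in>?P. pmf p u) = 1" and sq: "(\<Sum>v\<in>?Q. pmf q v) = 1"
    using fp fq by (auto intro: sum_pmf_eq_1)
  have diff: "pmf (bind_pmf p \<kappa>) y - pmf (bind_pmf q \<kappa>) y = (\<Sum>uv\<in>?P \<times> ?Q. ?w uv * ?D uv y)" for y
  proof -
    have bp: "pmf (bind_pmf p \<kappa>) y = (\<Sum>u\<in>?P. pmf (\<kappa> u) y * pmf p u)"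
      unfolding pmf_bind by (rule integral_measure_pmf_real) (use fp in auto)
    have bq: "pmf (bind_pmf q \<kappa>) y = (\<Sum>v\<in>?Q. pmf (\<kappa> v) y * pmf q v)"
      unfolding pmf_bind by (rule integral_measure_pmf_real) (use fq in auto)
    have "(\<Sum>uv\<in>?P \<times> ?Q. ?w uv * ?D uv y)
        = (\<Sum>u\<in>?P. \<Sum>v\<in>?Q. pmf p u * pmf q v * (pmf (\<kappa> u) y - pmf (\<kappa> v) y))"
      by (simp add: sum.cartesian_product split_def)
    also have "\<dots> = (\<Sum>u\<in>?P. \<Sum>v\<in>?Q. (pmf (\<kappa> u) y * pmf p u) * pmf q v)
        - (\<Sum>u\<in>?P. \<Sum>v\<in>?Q. pmf p u * (pmf (\<kappa> v) y * pmf q v))"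
      by (simp add: sum_subtractf[symmetric] algebra_simps)
    also have "\<dots> = (\<Sum>u\<in>?P. pmf (\<kappa> u) y * pmf p u) - (\<Sum>v\<in>?Q. pmf (\<kappa> v) y * pmf q v)"
      by (simp add: sum_product[symmetric] sp sq)
    finally show ?thesis using bp bq by simp
  qed
  have "(\<Sum>y\<in>B. \<bar>pmf (bind_pmf p \<kappa>) y - pmf (bind_pmf q \<kappa>) y\<bar>)
      \<le> (\<Sum>y\<in>B. \<Sum>uv\<in>?P \<times> ?Q. ?w uv * \<bar>?D uv y\<bar>)"
    unfolding diff
  proof (intro sum_mono)
    fix y
    have "\<bar>\<Sum>uv\<in>?P \<times> ?Q. ?w uv * ?D uv y\<bar> \<le> (\<Sum>uv\<in>?P \<times> ?Q. \<bar>?w uv * ?D uv y\<bar>)"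
      by (rule sum_abs)
    also have "\<dots> = (\<Sum>uv\<in>?P \<times> ?Q. ?w uv * \<bar>?D uv y\<bar>)"
      by (simp add: abs_mult)
    finally show "\<bar>\<Sum>uv\<in>?P \<times> ?Q. ?w uv * ?D uv y\<bar> \<le> \<dots>" .
  qed
  also have "\<dots> = (\<Sum>uv\<in>?P \<times> ?Q. ?w uv * (\<Sum>y\<in>B. \<bar>?D uv y\<bar>))"
    by (subst sum.swap) (simp add: sum_distrib_left)
  also have "\<dots> \<le> (\<Sum>uv\<in>?P \<times> ?Q. (?w uv - ?c uv) * b)"
  proof (intro sum_mono)
    fix uv assume uv: "uv \<in> ?P \<times> ?Q"
    show "?w uv * (\<Sum>y\<in>B. \<bar>?D uv y\<bar>) \<le> (?w uv - ?c uv) * b"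
    proof (cases "uv = (z, z)")
      case False
      have "(\<Sum>y\<in>B. \<bar>?D uv y\<bar>) \<le> b" using uv by (intro bound) auto
      then show ?thesis using False by (auto intro!: mult_left_mono)
    qed simp
  qed
  also have "\<dots> = ((\<Sum>uv\<in>?P \<times> ?Q. ?w uv) - (\<Sum>uv\<in>?P \<times> ?Q. ?c uv)) * b"
    by (simp add: sum_distrib_right[symmetric] sum_subtractf)
  also have "(\<Sum>uv\<in>?P \<times> ?Q. ?w uv) = 1"
    using sum_product[of "pmf p" ?P "pmf q" ?Q] sp sq by (simp add: sum.cartesian_product split_def)
  also have "(\<Sum>uv\<in>?P \<times> ?Q. ?c uv) = pmf p z * pmf q z"
    using fp fq by (auto simp: set_pmf_eq)
  finally show ?thesis .
qed

lemma l1_norm_finite: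
  assumes "finite B" "B \<subseteq> X" "\<And>y. y \<in> X - B \<Longrightarrow> \<nu> y = 0"
  shows "l1_norm X \<nu> = (\<Sum>y\<in>B. \<bar>\<nu> y\<bar>)"
proof -
  have "l1_norm X \<nu> = (\<Sum>\<^sub>\<infinity>y\<in>B. \<bar>\<nu> y\<bar>)"
    unfolding l1_norm_def using assms by (intro infsum_cong_neutral) auto
  then show ?thesis using assms by simp
qed

section \<open>Geometry of hyperbolic graphs\<close>

locale hyperbolic_graph = good_discrete_hyperbolic_space M d
  for M :: "'a set" and d :: "'a \<Rightarrow> 'a \<Rightarrow> real" +
  fixes \<delta> :: nat
  assumes \<delta>_pos: "\<delta> > 0"
    and \<delta>_hyperbolic: "delta_hyperbolic (real \<delta>)"
begin

lemma four_point:
  assumes "x \<in> M" "y \<in> M" "z \<in> M" "w \<in> M"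
  shows "d x w + d y z \<le> max (d x y + d z w) (d x z + d y w) + real \<delta>"
  using \<delta>_hyperbolic assms unfolding delta_hyperbolic_def by blast

lemma geodesic_point:
  assumes "x \<in> M" "y \<in> M"
  obtains n where "d x y = real n"
    and "\<And>k. k \<le> n \<Longrightarrow> \<exists>z\<in>M. d x z = real (n - k) \<and> d z y = real k"
proof -
  obtain E where E: "E \<subseteq> M \<times> M" "\<And>x y. x \<in> M \<Longrightarrow> y \<in> M \<Longrightarrow> (x, y) \<in> E\<^sup>*"
    and dE: "\<And>x y. x \<in> M \<Longrightarrow> y \<in> M \<Longrightarrow> d x y = real (LEAST n. (x, y) \<in> E ^^ n)"
    using graph_metric unfolding graph_metric_def by blast
  define n where "n = (LEAST n. (x, y) \<in> E ^^ n)"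
  have dn: "d x y = real n" using dE assms unfolding n_def by blast
  have "\<exists>m. (x, y) \<in> E ^^ m" using E(2)[OF assms] by (simp add: rtrancl_power)
  then have En: "(x, y) \<in> E ^^ n" unfolding n_def by (rule LeastI_ex)
  have le: "d u v \<le> real m" if "u \<in> M" "v \<in> M" "(u, v) \<in> E ^^ m" for u v m
    using dE[OF that(1,2)] Least_le[of "\<lambda>n. (u, v) \<in> E ^^ n", OF that(3)] by simp
  have "\<exists>z\<in>M. d x z = real (n - k) \<and> d z y = real k" if k: "k \<le> n" for k
  proof -
    have "(x, y) \<in> E ^^ (n - k) O E ^^ k"
      using En k by (simp flip: relpow_add)
    then obtain z where z: "(x, z) \<in> E ^^ (n - k)" "(z, y) \<in> E ^^ k" by blast
    have "(x, z) \<in> E\<^sup>*" using z(1) by (auto simp: rtrancl_power)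
    then have "z \<in> M" using assms(1) E(1) by (induction rule: rtrancl_induct) auto
    moreover have "d x z \<le> real (n - k)" "d z y \<le> real k"
      using le z assms \<open>z \<in> M\<close> by blast+
    moreover have "real n \<le> d x z + d z y"
      using triangle[of x z y] dn assms \<open>z \<in> M\<close> by simp
    moreover have "real (n - k) + real k = real n" using k by simp
    ultimately show ?thesis by (intro bexI[of _ z]) linarith+
  qed
  with dn show ?thesis using that by blast
qed

lemma finite_mcball: "finite (mcball x r)"
proof (cases "x \<in> M \<and> 0 \<le> r")
  case True
  then show ?thesis using uniformly_locally_finite unfolding uniformly_locally_finite_def by blast
next
  case False
  then have "mcball x r = {}" using order_trans[OF nonneg] by (auto simp: mcball_def)
  then show ?thesis by simp
qed

text \<open>The slack \<open>s\<close> of \<open>y\<close> is forgotten after a step of length at least \<open>(s - \<delta>) / 2\<close>.\<close>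

lemma slack_after_step:
  assumes "x \<in> M" "a \<in> M" "y \<in> geod s x a" "z \<in> geod (real \<delta>) y a"
    and "s \<le> real \<delta> + 2 * (d y a - d z a)"
  shows "z \<in> geod (2 * real \<delta>) x a"
proof -
  have yz: "y \<in> M" "z \<in> M" "d x y + d y a \<le> d x a + s" "d y z + d z a \<le> d y a + real \<delta>"
    using assms by (auto simp: geod_def)
  have "d y a + d x z \<le> max (d y x + d z a) (d y z + d x a) + real \<delta>"
    using four_point yz assms by blast
  then show ?thesis using yz assms commute[of x y] by (auto simp: geod_def)
qed

lemma sphere_geod_close:
  assumes "x \<in> M" "a \<in> M" "u \<in> geod s x a" "v \<in> geod s x a" "d u a = d v a"
  shows "d u v \<le> s + real \<delta>"
proof -
  have uv: "u \<in> M" "v \<in> M" "d x u + d u a \<le> d x a + s" "d x v + d v a \<le> d x a + s"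
    using assms by (auto simp: geod_def)
  have "d x a + d u v \<le> max (d x u + d v a) (d x v + d u a) + real \<delta>"
    using four_point uv assms by blast
  then show ?thesis using uv assms by auto
qed

text \<open>The bound on \<open>d u v\<close> lets the term \<open>d v a + d u z\<close> win in the four-point inequality.\<close>

lemma common_target:
  assumes "u \<in> M" "v \<in> M" "z \<in> M" "a \<in> M" "d u a = d v a" "d u z + d z a = d u a"
    and "d u v \<le> 2 * d u z"
  shows "z \<in> geod (real \<delta>) v a"
proof -
  have "d v z + d u a \<le> max (d v u + d z a) (d v a + d u z) + real \<delta>"
    using four_point[of v u a z] assms commute[of a z] by (simp add: add.commute)
  then show ?thesis using assms commute[of u v] by (auto simp: geod_def)
qed

section \<open>The walk towards a point\<close>

definition shadow :: "'a \<Rightarrow> nat \<Rightarrow> 'a \<Rightarrow> 'a set" where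
  "shadow a k x = msphere a (real k) \<inter> geod (real \<delta>) x a"

lemma shadow_iff:
  "z \<in> shadow a k x \<longleftrightarrow> a \<in> M \<and> z \<in> M \<and> d z a = real k \<and> d x z + d z a \<le> d x a + real \<delta>"
  by (auto simp: shadow_def msphere_def geod_def commute)

lemma finite_shadow: "finite (shadow a k x)"
  by (rule finite_subset[OF _ finite_mcball[of a "real k"]]) (auto simp: shadow_iff commute)

lemma shadow_nonempty:
  assumes "x \<in> M" "a \<in> M" "real k \<le> d x a"
  shows "shadow a k x \<noteq> {}"
proof -
  obtain n where n: "d x a = real n"
    and z: "\<And>k. k \<le> n \<Longrightarrow> \<exists>z\<in>M. d x z = real (n - k) \<and> d z a = real k"
    using geodesic_point assms by blast
  have "k \<le> n" using n assms by simp
  then obtain w where "w \<in> M" "d x w = real (n - k)" "d w a = real k" using z by blast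
  then have "w \<in> shadow a k x" using n \<open>k \<le> n\<close> assms by (simp add: shadow_iff of_nat_diff)
  then show ?thesis by blast
qed

text \<open>The number of steps is a parameter, and a walk of \<open>n\<close> steps visits the spheres of radius
  \<open>4\<delta>n, \<dots>, 4\<delta>\<close>. It is meant for starting points with \<open>d x a \<ge> 4\<delta>n\<close>: otherwise the shadow may be
  empty, and then \<^const>\<open>pmf_of_set\<close> is unspecified.\<close>

primrec walk :: "'a \<Rightarrow> nat \<Rightarrow> 'a \<Rightarrow> 'a pmf" where
  "walk a 0 x = return_pmf x"
| "walk a (Suc n) x = bind_pmf (pmf_of_set (shadow a (4 * \<delta> * Suc n) x)) (walk a n)"

text \<open>The walk can be stopped on each of the spheres that it visits, and its position there is
  within \<open>2\<delta>\<close> of being geodesic. This serves twice: for \<open>m = 0\<close> it locates the support of the walk, and for other \<open>m\<close>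
  it brings walks with different numbers of steps to a common sphere.\<close>

lemma walk_factor:
  assumes "m \<le> n" "x \<in> M" "a \<in> M" "real (4 * \<delta> * Suc n) \<le> d x a"
  shows "\<exists>V. finite (set_pmf V) \<and>
    set_pmf V \<subseteq> msphere a (real (4 * \<delta> * Suc m)) \<inter> geod (2 * real \<delta>) x a \<and>
    walk a (Suc n) x = bind_pmf V (walk a m)"
  using assms(1)
proof (induction m rule: inc_induct)
  case base
  let ?S = "shadow a (4 * \<delta> * Suc n) x"
  have "?S \<noteq> {}" using shadow_nonempty assms by blast
  moreover have "?S \<subseteq> msphere a (real (4 * \<delta> * Suc n)) \<inter> geod (2 * real \<delta>) x a"
    by (auto simp: shadow_def geod_def)
  ultimately show ?case
    using finite_shadow by (intro exI[of _ "pmf_of_set ?S"]) (simp del: of_nat_mult of_nat_Suc mult_Suc_right)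
next
  case (step m)
  let ?r = "4 * \<delta> * Suc m" and ?r' = "4 * \<delta> * Suc (Suc m)"
  obtain V where V: "finite (set_pmf V)"
      "set_pmf V \<subseteq> msphere a (real ?r') \<inter> geod (2 * real \<delta>) x a"
      "walk a (Suc n) x = bind_pmf V (walk a (Suc m))"
    using step.IH by blast
  let ?S = "shadow a ?r"
  have rr: "real ?r' = real ?r + 4 * real \<delta>" by (simp add: algebra_simps)
  have S: "finite (?S u)" "?S u \<noteq> {}"
      "?S u \<subseteq> msphere a (real ?r) \<inter> geod (2 * real \<delta>) x a" if "u \<in> set_pmf V" for u
  proof -
    have u: "u \<in> M" "d u a = real ?r'" "u \<in> geod (2 * real \<delta>) x a"
      using that V(2) by (auto simp: msphere_def commute)
    show "finite (?S u)" by (rule finite_shadow)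
    show "?S u \<noteq> {}" using u rr assms by (intro shadow_nonempty) auto
    show "?S u \<subseteq> msphere a (real ?r) \<inter> geod (2 * real \<delta>) x a"
    proof
      fix z assume z: "z \<in> ?S u"
      then have "d z a = real ?r" by (simp add: shadow_iff)
      then have "z \<in> geod (2 * real \<delta>) x a"
        using z u rr assms by (intro slack_after_step[of x a u "2 * real \<delta>" z]) (auto simp: shadow_def)
      then show "z \<in> msphere a (real ?r) \<inter> geod (2 * real \<delta>) x a"
        using z by (simp add: shadow_def)
    qed
  qed
  have set: "set_pmf (pmf_of_set (?S u)) = ?S u" if "u \<in> set_pmf V" for u
    using S[OF that] by simp
  let ?W = "bind_pmf V (\<lambda>u. pmf_of_set (?S u))"
  have W: "set_pmf ?W = (\<Union>u\<in>set_pmf V. ?S u)" using set by auto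
  have "finite (set_pmf ?W)" unfolding W using V(1) S(1) by blast
  moreover have "set_pmf ?W \<subseteq> msphere a (real ?r) \<inter> geod (2 * real \<delta>) x a"
    unfolding W using S(3) by blast
  moreover have "walk a (Suc n) x = bind_pmf ?W (walk a m)"
    unfolding V(3) bind_assoc_pmf by (rule bind_pmf_cong[OF refl]) (rule walk.simps)
  ultimately show ?case by blast
qed

lemma walk_support:
  assumes "x \<in> M" "a \<in> M" "real (4 * \<delta> * Suc n) \<le> d x a"
  shows "set_pmf (walk a (Suc n) x) \<subseteq> msphere a (4 * real \<delta>) \<inter> geod (2 * real \<delta>) x a"
proof -
  obtain V where "set_pmf V \<subseteq> msphere a (real (4 * \<delta> * Suc 0)) \<inter> geod (2 * real \<delta>) x a"
    "walk a (Suc n) x = bind_pmf V (walk a 0)"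
    using walk_factor[of 0 n x a] assms by blast
  moreover have "bind_pmf V (walk a 0) = V" by (simp add: bind_return_pmf' cong: bind_pmf_cong)
  ultimately show ?thesis by simp
qed

text \<open>Each step of two walkers in the strip around a geodesic makes them meet
  with probability at least \<open>1/K\<^sup>2\<close>.\<close>

lemma walk_contract:
  assumes K: "K > 0" "\<And>u. u \<in> M \<Longrightarrow> card (mcball u (5 * real \<delta>)) \<le> K"
    and B: "finite B" and x: "x \<in> M" and a: "a \<in> M"
    and u: "u \<in> msphere a (real (4 * \<delta> * Suc n)) \<inter> geod (4 * real \<delta>) x a"
    and v: "v \<in> msphere a (real (4 * \<delta> * Suc n)) \<inter> geod (4 * real \<delta>) x a"
  shows "(\<Sum>y\<in>B. \<bar>pmf (walk a n u) y - pmf (walk a n v) y\<bar>) \<le> 2 * (1 - 1 / real K ^ 2) ^ n"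
  using u v
proof (induction n arbitrary: u v)
  case 0
  show ?case using l1_pmf_le_2[OF B] by (simp del: walk.simps)
next
  case (Suc n)
  let ?r = "4 * \<delta> * Suc n" and ?r' = "4 * \<delta> * Suc (Suc n)"
  let ?W = "msphere a (real ?r) \<inter> geod (4 * real \<delta>) x a"
  let ?S = "shadow a ?r"
  let ?q = "1 - 1 / real K ^ 2"
  have rr: "real ?r' = real ?r + 4 * real \<delta>" by (simp add: algebra_simps)
  have S: "?S w \<noteq> {}" "?S w \<subseteq> ?W" "card (?S w) \<le> K"
    if w: "w \<in> msphere a (real ?r') \<inter> geod (4 * real \<delta>) x a" for w
  proof -
    have wM: "w \<in> M" "d w a = real ?r'" using w by (auto simp: msphere_def commute)
    show "?S w \<noteq> {}" using wM rr a by (intro shadow_nonempty) auto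
    show "?S w \<subseteq> ?W"
    proof
      fix z assume z: "z \<in> ?S w"
      then have "d z a = real ?r" by (simp add: shadow_iff)
      then have "z \<in> geod (2 * real \<delta>) x a"
        using z w wM rr x a by (intro slack_after_step[of x a w "4 * real \<delta>" z]) (auto simp: shadow_def)
      then show "z \<in> ?W" using z by (simp add: shadow_def geod_def)
    qed
    have "?S w \<subseteq> mcball w (5 * real \<delta>)"
      using wM rr by (auto simp: shadow_iff)
    then show "card (?S w) \<le> K"
      using K(2)[OF wM(1)] card_mono[OF finite_mcball] by (meson order_trans)
  qed
  have uv: "u \<in> M" "v \<in> M" "d u a = real ?r'" "d v a = real ?r'"
    using Suc.prems by (auto simp: msphere_def commute)
  have duv: "d u v \<le> 5 * real \<delta>"
    using sphere_geod_close[OF x a, of u "4 * real \<delta>" v] Suc.prems uv by simp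
  obtain m where m: "d u a = real m"
      "\<And>k. k \<le> m \<Longrightarrow> \<exists>z\<in>M. d u z = real (m - k) \<and> d z a = real k"
    using geodesic_point uv(1) a by blast
  have mr: "m = ?r'" using m(1) uv(3) by linarith
  obtain z where z: "z \<in> M" "d u z = real (m - ?r)" "d z a = real ?r"
    using m(2)[of ?r] mr by auto
  have duz: "d u z = 4 * real \<delta>" using z(2) mr by (simp add: algebra_simps)
  have zu: "z \<in> ?S u" using z duz uv rr a by (simp add: shadow_iff)
  have "z \<in> geod (real \<delta>) v a"
    using z duz uv rr duv a by (intro common_target[of u v z a]) auto
  then have zv: "z \<in> ?S v" using z a by (simp add: shadow_iff geod_def)
  have low: "1 / real K \<le> pmf (pmf_of_set (?S w)) z" if "?S w \<noteq> {}" "card (?S w) \<le> K" "z \<in> ?S w" for w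
  proof -
    have "card (?S w) > 0" using that finite_shadow by (simp add: card_gt_0_iff)
    then show ?thesis using that finite_shadow K(1) by (simp add: frac_le)
  qed
  let ?p = "pmf_of_set (?S u)" and ?p' = "pmf_of_set (?S v)"
  have "1 / real K * (1 / real K) \<le> pmf ?p z * pmf ?p' z"
    using low[of u] low[of v] S Suc.prems zu zv by (intro mult_mono) auto
  then have q: "1 - pmf ?p z * pmf ?p' z \<le> ?q" by (simp add: power2_eq_square)
  have "1 \<le> real K ^ 2" using K(1) by (intro one_le_power) simp
  then have q0: "0 \<le> ?q" by (subst diff_ge_0_iff_ge, subst divide_le_eq) simp
  have "(\<Sum>y\<in>B. \<bar>pmf (walk a (Suc n) u) y - pmf (walk a (Suc n) v) y\<bar>)
      \<le> (1 - pmf ?p z * pmf ?p' z) * (2 * ?q ^ n)"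
    unfolding walk.simps
  proof (rule l1_bind_contract)
    show "finite (set_pmf ?p)" "finite (set_pmf ?p')"
      using S Suc.prems finite_shadow by simp_all
    fix u' v' assume "u' \<in> set_pmf ?p" "v' \<in> set_pmf ?p'"
    then have "u' \<in> ?W" "v' \<in> ?W"
      using S Suc.prems finite_shadow by auto
    then show "(\<Sum>y\<in>B. \<bar>pmf (walk a n u') y - pmf (walk a n v') y\<bar>) \<le> 2 * ?q ^ n"
      by (rule Suc.IH)
  qed (rule B)
  also have "\<dots> \<le> ?q * (2 * ?q ^ n)"
    using q q0 by (intro mult_right_mono) auto
  finally show ?case by simp
qed

lemma walk_equivariant:
  assumes f: "bij_betw f M M" "\<And>x y. x \<in> M \<Longrightarrow> y \<in> M \<Longrightarrow> d (f x) (f y) = d x y"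
    and "x \<in> M" "a \<in> M" "real (4 * \<delta> * n) \<le> d x a"
  shows "walk (f a) n (f x) = map_pmf f (walk a n x)"
  using assms(3-)
proof (induction n arbitrary: x)
  case 0
  then show ?case by simp
next
  case (Suc n)
  let ?S = "shadow a (4 * \<delta> * Suc n) x"
  have fM: "f y \<in> M" if "y \<in> M" for y using that f(1) bij_betwE by blast
  have img: "shadow (f a) (4 * \<delta> * Suc n) (f x) = f ` ?S"
  proof (intro equalityI subsetI)
    fix w assume w: "w \<in> shadow (f a) (4 * \<delta> * Suc n) (f x)"
    then have "w \<in> M" by (simp add: shadow_iff)
    then obtain z where z: "z \<in> M" "w = f z" using f(1) by (auto simp: bij_betw_def)
    then have "z \<in> ?S" using w f(2) Suc.prems by (simp add: shadow_iff)
    then show "w \<in> f ` ?S" using z by blast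
  next
    fix w assume "w \<in> f ` ?S"
    then obtain z where z: "z \<in> ?S" "w = f z" by blast
    then have "z \<in> M" by (simp add: shadow_iff)
    then show "w \<in> shadow (f a) (4 * \<delta> * Suc n) (f x)"
      using z f(2) fM Suc.prems by (simp add: shadow_iff)
  qed
  have ne: "?S \<noteq> {}" using shadow_nonempty Suc.prems by blast
  have "?S \<subseteq> M" by (auto simp: shadow_iff)
  then have inj: "inj_on f ?S" using f(1) by (auto simp: bij_betw_def inj_on_subset)
  have "walk (f a) (Suc n) (f x) = bind_pmf (pmf_of_set ?S) (\<lambda>z. walk (f a) n (f z))"
    using ne inj finite_shadow
    by (simp add: img map_pmf_of_set_inj[symmetric] bind_map_pmf del: mult_Suc_right)
  also have "\<dots> = bind_pmf (pmf_of_set ?S) (\<lambda>z. map_pmf f (walk a n z))"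
  proof (rule bind_pmf_cong[OF refl])
    fix z assume "z \<in> set_pmf (pmf_of_set ?S)"
    then have "z \<in> ?S" using ne finite_shadow by (simp del: mult_Suc_right)
    then have "z \<in> M" "d z a = real (4 * \<delta> * Suc n)" by (auto simp: shadow_iff)
    then show "walk (f a) n (f z) = map_pmf f (walk a n z)"
      using Suc.IH Suc.prems by (simp add: algebra_simps)
  qed
  finally show ?case by (simp add: map_bind_pmf)
qed

section \<open>The measures\<close>

definition steps :: "'a \<Rightarrow> 'a \<Rightarrow> nat" where
  "steps x a = nat \<lfloor>d x a\<rfloor> div (4 * \<delta>)"

definition approach :: "'a \<Rightarrow> 'a \<Rightarrow> 'a pmf" where
  "approach x a = walk a (steps x a) x"

lemma steps_bounds:
  assumes "x \<in> M" "a \<in> M"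
  shows "real (4 * \<delta> * steps x a) \<le> d x a" "d x a < real (4 * \<delta> * Suc (steps x a))"
proof -
  obtain n where n: "d x a = real n" using geodesic_point assms by blast
  then have s: "steps x a = n div (4 * \<delta>)" by (simp add: steps_def)
  have "4 * \<delta> * (n div (4 * \<delta>)) \<le> n" by simp
  moreover have "n < 4 * \<delta> * Suc (n div (4 * \<delta>))"
    using dividend_less_times_div[of "4 * \<delta>" n] \<delta>_pos by simp
  ultimately show "real (4 * \<delta> * steps x a) \<le> d x a" "d x a < real (4 * \<delta> * Suc (steps x a))"
    unfolding n s by (simp_all only: of_nat_le_iff of_nat_less_iff)
qed

lemma approach_support_far:
  assumes "x \<in> M" "a \<in> M" "4 * real \<delta> \<le> d x a"
  shows "set_pmf (approach x a) \<subseteq> msphere a (4 * real \<delta>) \<inter> geod (2 * real \<delta>) x a"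
proof (cases "steps x a")
  case 0
  then show ?thesis using steps_bounds(2)[of x a] assms by simp
next
  case (Suc n)
  then have "real (4 * \<delta> * Suc n) \<le> d x a" using steps_bounds(1)[of x a] assms by metis
  then show ?thesis
    using walk_support[of x a n] assms unfolding approach_def Suc by blast
qed

lemma approach_support:
  assumes "x \<in> M" "a \<in> M"
  shows "set_pmf (approach x a) \<subseteq> mcball a (4 * real \<delta>) \<inter> geod (2 * real \<delta>) x a"
proof (cases "4 * real \<delta> \<le> d x a")
  case True
  have "msphere a (4 * real \<delta>) \<subseteq> mcball a (4 * real \<delta>)" by (auto simp: msphere_def)
  then show ?thesis using approach_support_far[OF assms True] by blast
next
  case False
  have "steps x a = 0"
  proof (rule ccontr)
    assume "steps x a \<noteq> 0"
    then have "4 * \<delta> * 1 \<le> 4 * \<delta> * steps x a" by (intro mult_le_mono2) simp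
    then have "real (4 * \<delta> * 1) \<le> real (4 * \<delta> * steps x a)" by (rule of_nat_mono)
    also have "\<dots> \<le> d x a" by (rule steps_bounds(1)[OF assms])
    finally show False using False by simp
  qed
  then show ?thesis using False assms by (auto simp: approach_def geod_def commute)
qed

lemma approach_equivariant:
  assumes f: "bij_betw f M M" "\<And>x y. x \<in> M \<Longrightarrow> y \<in> M \<Longrightarrow> d (f x) (f y) = d x y"
    and "x \<in> M" "a \<in> M"
  shows "approach (f x) (f a) = map_pmf f (approach x a)"
proof -
  have "steps (f x) (f a) = steps x a" using assms by (simp add: steps_def)
  then show ?thesis
    using walk_equivariant[OF assms steps_bounds(1)[OF assms(3,4)]] unfolding approach_def by metis
qed

text \<open>The walks from \<open>x\<close> and \<open>x'\<close> may differ in their number of steps, but both visit the sphere of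
  radius \<open>4\<delta>n\<close> around \<open>a\<close> if \<open>n > 0\<close>, and from there on \<open>walk_contract\<close> applies. The
  slack \<open>2\<delta>\<close> relative to \<open>x'\<close> is a slack \<open>2\<delta> + 2 \<le> 4\<delta>\<close> relative to \<open>x\<close>.\<close>

lemma approach_contract:
  assumes K: "K > 0" "\<And>u. u \<in> M \<Longrightarrow> card (mcball u (5 * real \<delta>)) \<le> K"
    and x: "x \<in> M" and x': "x' \<in> M" and a: "a \<in> M" and adj: "d x x' = 1" and B: "finite B"
  defines "n \<equiv> min (steps x a) (steps x' a)"
  shows "(\<Sum>y\<in>B. \<bar>pmf (approach x a) y - pmf (approach x' a) y\<bar>) \<le> 2 * (1 - 1 / real K ^ 2) ^ (n - 1)"
proof (cases n)
  case 0
  then show ?thesis using l1_pmf_le_2[OF B] by simp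
next
  case (Suc m)
  let ?W = "msphere a (real (4 * \<delta> * Suc m)) \<inter> geod (4 * real \<delta>) x a"
  have tri: "d x a \<le> 1 + d x' a" "d x' a \<le> 1 + d x a"
    using triangle[of x x' a] triangle[of x' x a] x x' a adj commute[of x x'] by auto
  have \<delta>1: "real \<delta> \<ge> 1" using \<delta>_pos by simp
  have factor: "\<exists>V. finite (set_pmf V) \<and>
      set_pmf V \<subseteq> msphere a (real (4 * \<delta> * Suc m)) \<inter> geod (2 * real \<delta>) y a \<and>
      approach y a = bind_pmf V (walk a m)" if y: "y \<in> M" "Suc m \<le> steps y a" for y
  proof -
    obtain k where k: "steps y a = Suc k" "m \<le> k" using y(2) by (cases "steps y a") auto
    then show ?thesis
      using walk_factor[of m k y a] steps_bounds(1)[OF y(1) a] y a by (simp add: approach_def)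
  qed
  have le: "Suc m \<le> steps x a" "Suc m \<le> steps x' a" using Suc by (auto simp: n_def)
  obtain V where V: "finite (set_pmf V)"
      "set_pmf V \<subseteq> msphere a (real (4 * \<delta> * Suc m)) \<inter> geod (2 * real \<delta>) x a"
      "approach x a = bind_pmf V (walk a m)"
    using factor[OF x le(1)] by blast
  obtain V' where V': "finite (set_pmf V')"
      "set_pmf V' \<subseteq> msphere a (real (4 * \<delta> * Suc m)) \<inter> geod (2 * real \<delta>) x' a"
      "approach x' a = bind_pmf V' (walk a m)"
    using factor[OF x' le(2)] by blast
  have "geod (2 * real \<delta>) x a \<subseteq> geod (4 * real \<delta>) x a" by (auto simp: geod_def)
  then have VW: "set_pmf V \<subseteq> ?W" using V(2) by blast
  have "geod (2 * real \<delta>) x' a \<subseteq> geod (4 * real \<delta>) x a"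
  proof
    fix z assume "z \<in> geod (2 * real \<delta>) x' a"
    then have "z \<in> M" "d x' z + d z a \<le> d x' a + 2 * real \<delta>" by (auto simp: geod_def)
    moreover have "d x z \<le> 1 + d x' z" using triangle[of x x' z] x x' adj \<open>z \<in> M\<close> by simp
    ultimately show "z \<in> geod (4 * real \<delta>) x a" using tri \<delta>1 by (simp add: geod_def)
  qed
  then have VW': "set_pmf V' \<subseteq> ?W" using V'(2) by blast
  let ?q = "1 - 1 / real K ^ 2"
  have "1 \<le> real K ^ 2" using K(1) by (intro one_le_power) simp
  then have q0: "0 \<le> ?q" by (subst diff_ge_0_iff_ge, subst divide_le_eq) simp
  \<comment> \<open>Only convexity of the \<open>\<ell>\<^sup>1\<close> distance matters at this point, so that any \<open>z\<close> will do.\<close>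
  have "(\<Sum>y\<in>B. \<bar>pmf (approach x a) y - pmf (approach x' a) y\<bar>) \<le> (1 - pmf V x * pmf V' x) * (2 * ?q ^ m)"
    unfolding V(3) V'(3)
  proof (rule l1_bind_contract[OF V(1) V'(1) B])
    fix u v assume "u \<in> set_pmf V" "v \<in> set_pmf V'"
    then have "u \<in> ?W" "v \<in> ?W" using VW VW' by auto
    then show "(\<Sum>y\<in>B. \<bar>pmf (walk a m u) y - pmf (walk a m v) y\<bar>) \<le> 2 * ?q ^ m"
      by (intro walk_contract[of K B x a] K B x a)
  qed
  also have "\<dots> \<le> 1 * (2 * ?q ^ m)"
    using q0 by (intro mult_right_mono) (auto intro: mult_nonneg_nonneg)
  finally show ?thesis using Suc by simp
qed

lemma approach_exponential_decay:
  "\<exists>\<epsilon>>0. \<exists>C::real. \<forall>x\<in>M. \<forall>x'\<in>M. \<forall>a\<in>M. d x x' = 1 \<longrightarrow>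
     l1_norm M (\<lambda>y. pmf (approach x a) y - pmf (approach x' a) y) \<le> C * exp (- \<epsilon> * d x a)"
proof -
  obtain K0 where K0: "\<And>u. u \<in> M \<Longrightarrow> card (mcball u (5 * real \<delta>)) \<le> K0"
    using uniformly_locally_finite unfolding uniformly_locally_finite_def
    by (meson mult_nonneg_nonneg of_nat_0_le_iff zero_le_numeral)
  \<comment> \<open>With \<open>K \<ge> 2\<close> the rate \<open>q\<close> is positive and has a logarithm.\<close>
  define K where "K = max 2 K0"
  have K: "K > 0" "\<And>u. u \<in> M \<Longrightarrow> card (mcball u (5 * real \<delta>)) \<le> K"
    using K0 by (auto simp: K_def intro: le_max_iff_disj[THEN iffD2])
  define q where "q = 1 - 1 / real K ^ 2"
  have "real K \<ge> 2" by (simp add: K_def)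
  then have "real K ^ 2 > 1" by (simp add: one_less_power)
  then have q: "0 < q" "q < 1" using K(1) by (simp_all add: q_def)
  define \<epsilon> where "\<epsilon> = - ln q / (4 * real \<delta>)"
  have \<epsilon>: "\<epsilon> > 0" using q \<delta>_pos unfolding \<epsilon>_def by (intro divide_pos_pos) auto
  have "l1_norm M (\<lambda>y. pmf (approach x a) y - pmf (approach x' a) y) \<le> 2 / q\<^sup>2 * exp (- \<epsilon> * d x a)"
    if x: "x \<in> M" and x': "x' \<in> M" and a: "a \<in> M" and adj: "d x x' = 1" for x x' a
  proof -
    define n where "n = min (steps x a) (steps x' a)"
    have decay: "q ^ Suc n \<le> exp (- \<epsilon> * d x a)"
    proof -
      have "d x a \<le> 1 + d x' a" using triangle[of x x' a] x x' a adj by simp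
      moreover obtain k l where "d x a = real k" "d x' a = real l"
        using geodesic_point x x' a by metis
      ultimately have "k \<le> 1 + l" by linarith
      have "d x a \<le> real (4 * \<delta> * Suc n)"
      proof (cases "steps x a \<le> steps x' a")
        case True
        then have "n = steps x a" by (simp add: n_def)
        then show ?thesis using steps_bounds(2)[OF x a] by (metis less_imp_le)
      next
        case False
        then have "n = steps x' a" by (simp add: n_def)
        then have "real l < real (4 * \<delta> * Suc n)"
          using steps_bounds(2)[OF x' a] \<open>d x' a = real l\<close> by metis
        then have "l < 4 * \<delta> * Suc n" by (simp only: of_nat_less_iff)
        then have "1 + l \<le> 4 * \<delta> * Suc n" by (simp only: plus_1_eq_Suc Suc_le_eq)
        with \<open>k \<le> 1 + l\<close> have "k \<le> 4 * \<delta> * Suc n" by (rule order_trans)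
        then show ?thesis unfolding \<open>d x a = real k\<close> by (simp only: of_nat_le_iff)
      qed
      then have "\<epsilon> * d x a \<le> \<epsilon> * real (4 * \<delta> * Suc n)"
        using \<epsilon> by (intro mult_left_mono) auto
      also have "\<dots> = (\<epsilon> * (4 * real \<delta>)) * real (Suc n)"
        by (simp only: of_nat_mult of_nat_numeral mult.assoc)
      also have "\<epsilon> * (4 * real \<delta>) = - ln q" using \<delta>_pos by (simp add: \<epsilon>_def)
      finally have "real (Suc n) * ln q \<le> - \<epsilon> * d x a"
        by (simp only: mult.commute[of "real (Suc n)"] mult_minus_left)
      then have "exp (real (Suc n) * ln q) \<le> exp (- \<epsilon> * d x a)" by (simp only: exp_le_cancel_iff)
      then show ?thesis using q by (simp only: exp_of_nat_mult exp_ln)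
    qed
    let ?B = "set_pmf (approach x a) \<union> set_pmf (approach x' a)"
    have sub: "?B \<subseteq> mcball a (4 * real \<delta>)" using approach_support x x' a by blast
    have fin: "finite ?B" by (rule finite_subset[OF sub finite_mcball])
    have "?B \<subseteq> M" using sub by auto
    then have "l1_norm M (\<lambda>y. pmf (approach x a) y - pmf (approach x' a) y)
        = (\<Sum>y\<in>?B. \<bar>pmf (approach x a) y - pmf (approach x' a) y\<bar>)"
      using fin by (intro l1_norm_finite) (auto simp: set_pmf_iff)
    also have "\<dots> \<le> 2 * q ^ (n - 1)"
      unfolding q_def n_def by (intro approach_contract K x x' a adj fin)
    also have "\<dots> = 2 / q\<^sup>2 * q ^ (2 + (n - 1))"
      using q by (simp only: power_add) simp
    also have "\<dots> \<le> 2 / q\<^sup>2 * q ^ Suc n"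
      using q by (intro mult_left_mono power_decreasing) auto
    also have "2 / q\<^sup>2 * q ^ Suc n \<le> 2 / q\<^sup>2 * exp (- \<epsilon> * d x a)"
      using q decay by (intro mult_left_mono) auto
    finally show ?thesis .
  qed
  then show ?thesis using \<epsilon> by blast
qed

lemma disjoint_supports:
  assumes "x \<in> M" "x' \<in> M" "a \<in> M" "d x a + d a x' = d x x'"
    and "4 * real \<delta> \<le> d x a" "4 * real \<delta> \<le> d a x'"
  shows "set_pmf (approach x a) \<inter> set_pmf (approach x' a) = {}"
proof (rule ccontr)
  assume "\<not> ?thesis"
  then obtain z where z: "z \<in> set_pmf (approach x a)" "z \<in> set_pmf (approach x' a)" by blast
  have "z \<in> msphere a (4 * real \<delta>) \<inter> geod (2 * real \<delta>) x a"
    using z(1) approach_support_far[of x a] assms by blast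
  moreover have "z \<in> geod (2 * real \<delta>) x' a"
    using z(2) approach_support_far[of x' a] assms commute[of a x'] by auto
  ultimately have "z \<in> M" "d z a = 4 * real \<delta>"
    "d x z + d z a \<le> d x a + 2 * real \<delta>" "d x' z + d z a \<le> d x' a + 2 * real \<delta>"
    by (auto simp: msphere_def geod_def commute)
  moreover have "d x x' \<le> d x z + d x' z"
    using triangle[of x z x'] commute[of x' z] assms \<open>z \<in> M\<close> by simp
  moreover have "real \<delta> > 0" using \<delta>_pos by simp
  ultimately show False using assms commute[of a x'] by linarith
qed

lemma many_disjoint_supports:
  assumes x: "x \<in> M" "x' \<in> M" and far: "16 * real \<delta> \<le> d x x'"
  defines "A \<equiv> {a \<in> M. set_pmf (approach x a) \<inter> set_pmf (approach x' a) = {}}"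
  shows "infinite A \<or> d x x' / 2 \<le> real (card A)"
proof (cases "finite A")
  case True
  obtain n where n: "d x x' = real n"
    and ex: "\<And>k. k \<le> n \<Longrightarrow> \<exists>z\<in>M. d x z = real (n - k) \<and> d z x' = real k"
    using geodesic_point x by blast
  have "\<forall>k\<in>{..n}. \<exists>z. z \<in> M \<and> d x z = real (n - k) \<and> d z x' = real k"
    using ex by blast
  from bchoice[OF this] obtain p
    where p: "\<And>k. k \<le> n \<Longrightarrow> p k \<in> M \<and> d x (p k) = real (n - k) \<and> d (p k) x' = real k"
    by blast
  let ?I = "{4 * \<delta>..n - 4 * \<delta>}"
  have n16: "16 * \<delta> \<le> n" using far n by linarith
  have "inj_on p ?I"
  proof (rule inj_onI)
    fix i j assume ij: "i \<in> ?I" "j \<in> ?I" "p i = p j"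
    then have "i \<le> n" "j \<le> n" by auto
    then have "d (p i) x' = real i" "d (p j) x' = real j" by (simp_all only: p)
    with ij(3) have "real i = real j" by metis
    then show "i = j" by (simp only: of_nat_eq_iff)
  qed
  moreover have "p ` ?I \<subseteq> A"
  proof
    fix a assume "a \<in> p ` ?I"
    then obtain k where k: "4 * \<delta> \<le> k" "k \<le> n - 4 * \<delta>" "a = p k" by auto
    then have "k \<le> n" by simp
    from p[OF this] have pk: "a \<in> M" "d x a = real (n - k)" "d a x' = real k" unfolding k(3) by blast+
    have "4 * \<delta> \<le> n - k" using k(2) n16 by linarith
    then have "4 * real \<delta> \<le> d x a" "4 * real \<delta> \<le> d a x'"
      using k(1) of_nat_mono[of "4 * \<delta>" "n - k", where ?'a = real]
        of_nat_mono[of "4 * \<delta>" k, where ?'a = real] unfolding pk by auto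
    moreover have "d x a + d a x' = d x x'" unfolding pk n using \<open>k \<le> n\<close> by simp
    ultimately show "a \<in> A" using disjoint_supports[of x x' a] x pk(1) unfolding A_def by blast
  qed
  ultimately have "card ?I \<le> card A" using True by (metis card_inj_on_le)
  moreover have "n \<le> 2 * card ?I" using n16 by auto
  ultimately have "n \<le> 2 * card A" by linarith
  then show ?thesis using n by simp
qed simp

end

theorem mainTheorem1:
  fixes X :: "'a set" and d :: "'a \<Rightarrow> 'a \<Rightarrow> real"
    and G :: "('g, 'm) monoid_scheme" and \<phi> :: "'g \<Rightarrow> 'a \<Rightarrow> 'a"
    and \<delta> :: nat
  assumes "good_discrete_hyperbolic_space X d"
    and "isometric_action X d G \<phi>"
    and "\<delta> > 0"
    and "Metric_space.delta_hyperbolic X d (real \<delta>)"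
  shows "\<exists>\<mu> :: 'a \<Rightarrow> 'a \<Rightarrow> 'a pmf.
    (\<forall>x\<in>X. \<forall>a\<in>X. set_pmf (\<mu> x a) \<subseteq> X) \<and>
    (\<forall>g\<in>carrier G. \<forall>x\<in>X. \<forall>a\<in>X. \<mu> (\<phi> g x) (\<phi> g a) = map_pmf (\<phi> g) (\<mu> x a)) \<and>
    (\<forall>x\<in>X. \<forall>a\<in>X.
       set_pmf (\<mu> x a) \<subseteq>
         Metric_space.mcball X d a (4 * real \<delta>) \<inter> Metric_space.geod X d (2 * real \<delta>) x a \<and>
       (d x a \<ge> 4 * real \<delta> \<longrightarrow>
         set_pmf (\<mu> x a) \<subseteq>
           Metric_space.msphere X d a (4 * real \<delta>) \<inter> Metric_space.geod X d (2 * real \<delta>) x a)) \<and>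
    (\<exists>\<epsilon>>0. \<exists>C::real. \<forall>x\<in>X. \<forall>x'\<in>X. \<forall>a\<in>X. d x x' = 1 \<longrightarrow>
       l1_norm X (\<lambda>y. pmf (\<mu> x a) y - pmf (\<mu> x' a) y) \<le> C * exp (- \<epsilon> * d x a)) \<and>
    (\<exists>\<eta>>0. \<exists>R::real. \<forall>x\<in>X. \<forall>x'\<in>X. d x x' \<ge> R \<longrightarrow>
       (let A = {a \<in> X. set_pmf (\<mu> x a) \<inter> set_pmf (\<mu> x' a) = {}}
        in infinite A \<or> real (card A) \<ge> \<eta> * d x x'))"
proof -
  interpret good_discrete_hyperbolic_space X d by (rule assms(1))
  interpret isometric_action X d G \<phi> by (rule assms(2))
  interpret hyperbolic_graph X d \<delta> by unfold_locales (rule assms(3,4))+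
  have act: "bij_betw (\<phi> g) X X" "\<And>x y. x \<in> X \<Longrightarrow> y \<in> X \<Longrightarrow> d (\<phi> g x) (\<phi> g y) = d x y"
    if "g \<in> carrier G" for g
    using inj_prop[OF that] surj_prop[OF that] isometric[OF that] by (auto simp: bij_betw_def)
  have "\<forall>x\<in>X. \<forall>a\<in>X. set_pmf (approach x a) \<subseteq> X"
    using approach_support by fastforce
  moreover have "\<forall>g\<in>carrier G. \<forall>x\<in>X. \<forall>a\<in>X. approach (\<phi> g x) (\<phi> g a) = map_pmf (\<phi> g) (approach x a)"
    using approach_equivariant[OF act] by blast
  moreover have "\<exists>\<eta>>0. \<exists>R::real. \<forall>x\<in>X. \<forall>x'\<in>X. d x x' \<ge> R \<longrightarrow>
       (let A = {a \<in> X. set_pmf (approach x a) \<inter> set_pmf (approach x' a) = {}}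
        in infinite A \<or> real (card A) \<ge> \<eta> * d x x')"
    using many_disjoint_supports
    by (intro exI[of _ "1/2 :: real"] conjI exI[of _ "16 * real \<delta>"]) (auto simp: Let_def)
  moreover have "\<forall>x\<in>X. \<forall>a\<in>X.
      set_pmf (approach x a) \<subseteq> mcball a (4 * real \<delta>) \<inter> geod (2 * real \<delta>) x a \<and>
      (d x a \<ge> 4 * real \<delta> \<longrightarrow>
        set_pmf (approach x a) \<subseteq> msphere a (4 * real \<delta>) \<inter> geod (2 * real \<delta>) x a)"
    using approach_support approach_support_far by blast
  ultimately show ?thesis
    by (intro exI[of _ approach] conjI approach_exponential_decay)
qed

end
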